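(* Let $\mathcal{G}=(\mathcal{V},\mathcal{E})$ be a connected undirected graph on $\{1,\dots,N\}$, $N\ge2$, with spectral radius $\rho$, and let $0\le p<1$. Consider the noisy max-consensus recursion on the random time-varying graph obtained from $\mathcal{G}$ by deleting each edge with probability $p$, independently across edges and time, with i.i.d. zero-mean noise whose moment generating function $M(\gamma)=\mathbb{E}[e^{\gamma v_{ij}(t)}]$ is finite in a neighborhood of the origin, and let $\lambda$ be its growth rate. Then $$\lambda\ \le\ \inf\Big\{x:\ \sup_{0\le\beta\le1}\Big[H(\beta)+\beta\log\big(\rho(1-p)\big)-\beta I\Big(\frac{x}{\beta}\Big)\Big]<0\Big\},$$ where $H(\beta)=-\beta\log\beta-(1-\beta)\log(1-\beta)$ and $I(x)=\sup_{\gamma>0}(x\gamma-\log M(\gamma))$.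
   Context: The recursion is $x_i(t+1)=\max\big(x_i(t),\max_{j\in\mathcal{N}_i}(x_j(t)+w_{ij}(t))\big)$, where $\mathcal{N}_i$ is the set of neighbors of $i$ in $\mathcal{G}$, and for each ordered pair $(i,j)$ with $\{i,j\}\in\mathcal{E}$ and each time $t=0,1,2,\dots$: $w_{ij}(t)=v_{ij}(t)$ with probability $1-p$ and $w_{ij}(t)=-\infty$ (edge absent) with probability $p$, the deletions being independent across edges and time and independent of the noise; the noise samples $v_{ij}(t)$ are i.i.d. real random variables with zero mean. Initial values $x_1(0),\dots,x_N(0)$ are arbitrary fixed real numbers. The growth rate $\lambda$ is the real constant, known to exist and to be independent of $i$ and of the initial values, such that $\lambda=\lim_{t\to\infty}x_i(t)/t$ almost surely and $\lambda=\lim_{t\to\infty}\mathbb{E}[x_i(t)]/t$ for all $i$. $\rho$ is the largest absolute value of an eigenvalue of the 0/1 adjacency matrix of $\mathcal{G}$. $\log$ is natural, $0\log0=0$; $M(\gamma)$ may be $+\infty$ away from the origin (then $-\log M(\gamma)=-\infty$); at $\beta=0$ the term $\beta I(x/\beta)$ is understood as its limit as $\beta\to0^+$. *)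

theory Defs
  imports
    "HOL-Probability.Probability"
    "Graph_Theory.Pair_Digraph"
    "Graph_Theory.Digraph_Component"
    "Jordan_Normal_Form.Spectral_Radius"
begin

definition neighbors :: "nat pair_pre_digraph \<Rightarrow> nat \<Rightarrow> nat set" where
  "neighbors G i = {j. (i, j) \<in> parcs G}"

text \<open>Matrix indices start at 0, the vertices \<open>1, \<dots>, N\<close> start at 1.\<close>

definition adjacency_matrix :: "nat pair_pre_digraph \<Rightarrow> nat \<Rightarrow> complex mat" where
  "adjacency_matrix G N =
     mat N N (\<lambda>(i, j). if (Suc i, Suc j) \<in> parcs G then 1 else 0)"

definition link_weight ::
    "(nat \<times> nat \<Rightarrow> nat \<Rightarrow> 'w \<Rightarrow> bool) \<Rightarrow> (nat \<times> nat \<Rightarrow> nat \<Rightarrow> 'w \<Rightarrow> real) \<Rightarrow>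
     'w \<Rightarrow> nat \<times> nat \<Rightarrow> nat \<Rightarrow> ereal" where
  "link_weight absent v \<omega> a t = (if absent a t \<omega> then -\<infinity> else ereal (v a t \<omega>))"

text \<open>The extended real inside \<^const>\<open>real_of_ereal\<close> is always finite for link weights as
  above: it is a maximum over finitely many values below \<open>\<infinity>\<close>, one of which is a real number.\<close>

primrec consensus_state ::
    "nat pair_pre_digraph \<Rightarrow> (nat \<times> nat \<Rightarrow> nat \<Rightarrow> ereal) \<Rightarrow> (nat \<Rightarrow> real) \<Rightarrow>
     nat \<Rightarrow> nat \<Rightarrow> real" where
  "consensus_state G w x0 0 i = x0 i"
| "consensus_state G w x0 (Suc t) i =
     real_of_ereal
       (max (ereal (consensus_state G w x0 t i))
            (SUP j\<in>neighbors G i. ereal (consensus_state G w x0 t j) + w (i, j) t))"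

text \<open>Link deletions. The event that \<open>w\<^sub>i\<^sub>j(t) = -\<infinity>\<close> has probability \<open>p\<close> for every ordered
  pair. Independence is across undirected edges \<open>{i, j}\<close>, represented by \<open>i < j\<close>, and across time;
  the joint law of the two directions of one edge at one time is left open. This covers both
  simultaneous deletion of the two directions and independent deletion of each of them.\<close>

definition random_deletions ::
    "'w measure \<Rightarrow> nat pair_pre_digraph \<Rightarrow> real \<Rightarrow> (nat \<times> nat \<Rightarrow> nat \<Rightarrow> 'w \<Rightarrow> bool) \<Rightarrow> bool"
  where
  "random_deletions P G p absent \<longleftrightarrow>
     prob_space.indep_vars P (\<lambda>_. count_space UNIV)
       (\<lambda>((i, j), t) \<omega>. (absent (i, j) t \<omega>, absent (j, i) t \<omega>))
       ({(i, j) \<in> parcs G. i < j} \<times> UNIV) \<and>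
     (\<forall>a \<in> parcs G. \<forall>t. measure P {\<omega> \<in> space P. absent a t \<omega>} = p)"

definition iid_noise ::
    "'w measure \<Rightarrow> nat pair_pre_digraph \<Rightarrow> real measure \<Rightarrow>
     (nat \<times> nat \<Rightarrow> nat \<Rightarrow> 'w \<Rightarrow> real) \<Rightarrow> bool" where
  "iid_noise P G \<mu> v \<longleftrightarrow>
     prob_space.indep_vars P (\<lambda>_. borel) (\<lambda>(a, t). v a t) (parcs G \<times> UNIV) \<and>
     (\<forall>a \<in> parcs G. \<forall>t. distr P borel (v a t) = \<mu>)"

text \<open>The two processes generate independent sigma-algebras (\<open>indep_var\<close> needs equal types).\<close>

definition deletions_indep_noise ::
    "'w measure \<Rightarrow> nat pair_pre_digraph \<Rightarrow> (nat \<times> nat \<Rightarrow> nat \<Rightarrow> 'w \<Rightarrow> bool) \<Rightarrow>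
     (nat \<times> nat \<Rightarrow> nat \<Rightarrow> 'w \<Rightarrow> real) \<Rightarrow> bool" where
  "deletions_indep_noise P G absent v \<longleftrightarrow>
     prob_space.indep_set P
       (sets (vimage_algebra (space P) (\<lambda>\<omega>. \<lambda>(a, t) \<in> parcs G \<times> UNIV. absent a t \<omega>)
          (PiM (parcs G \<times> UNIV) (\<lambda>_. count_space UNIV))))
       (sets (vimage_algebra (space P) (\<lambda>\<omega>. \<lambda>(a, t) \<in> parcs G \<times> UNIV. v a t \<omega>)
          (PiM (parcs G \<times> UNIV) (\<lambda>_. borel))))"

definition growth_rate ::
    "'w measure \<Rightarrow> nat pair_pre_digraph \<Rightarrow> ('w \<Rightarrow> nat \<Rightarrow> nat \<Rightarrow> real) \<Rightarrow> real \<Rightarrow> bool" where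
  "growth_rate P G x lam \<longleftrightarrow>
     (\<forall>i \<in> pverts G.
        (AE \<omega> in P. (\<lambda>t. x \<omega> t i / real t) \<longlonglongrightarrow> lam) \<and>
        (\<lambda>t. (\<integral>\<omega>. x \<omega> t i \<partial>P) / real t) \<longlonglongrightarrow> lam)"

definition mgf :: "real measure \<Rightarrow> real \<Rightarrow> ennreal" where
  "mgf \<mu> \<gamma> = (\<integral>\<^sup>+ y. ennreal (exp (\<gamma> * y)) \<partial>\<mu>)"

definition log_mgf :: "real measure \<Rightarrow> real \<Rightarrow> ereal" where
  "log_mgf \<mu> \<gamma> = (if mgf \<mu> \<gamma> = \<infinity> then \<infinity> else ereal (ln (enn2real (mgf \<mu> \<gamma>))))"

definition rate_function :: "real measure \<Rightarrow> real \<Rightarrow> ereal" where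
  "rate_function \<mu> x = (SUP \<gamma>\<in>{0<..}. ereal (x * \<gamma>) - log_mgf \<mu> \<gamma>)"

text \<open>The term \<open>\<beta> I(x/\<beta>)\<close>.\<close>

definition scaled_rate :: "real measure \<Rightarrow> real \<Rightarrow> real \<Rightarrow> ereal" where
  "scaled_rate \<mu> x \<beta> =
     (if \<beta> = 0 then Lim (at_right 0) (\<lambda>b. ereal b * rate_function \<mu> (x / b))
      else ereal \<beta> * rate_function \<mu> (x / \<beta>))"

text \<open>The convention \<open>0 log 0 = 0\<close> holds because of the factor 0.\<close>

definition entropy_fun :: "real \<Rightarrow> real" where
  "entropy_fun \<beta> = - \<beta> * ln \<beta> - (1 - \<beta>) * ln (1 - \<beta>)"

end

theory Submission
  imports Defs "HOL-Real_Asymp.Real_Asymp"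
begin

text \<open>Unfolding the recursion, \<open>x\<^sub>i(t)\<close> is at most \<open>max\<^sub>j x\<^sub>j(0)\<close> plus the largest weight of a lazy walk
  of length \<open>t\<close> from \<open>i\<close>. There are at most \<open>C r\<^sup>k\<close> walks with \<open>k\<close> steps when \<open>r > \<rho>\<close>, and
  \<open>t choose k \<le> exp (t H(k/t))\<close> ways to place the steps in time; each such walk survives with probability
  \<open>(1 - p)\<^sup>k\<close>. A Chernoff bound whose parameter \<open>\<gamma>\<close> depends on \<open>\<beta> = k/t\<close> then makes the probability that
  some walk with \<open>k\<close> steps has weight above \<open>x t\<close> exponentially small, uniformly in \<open>k \<ge> 1\<close>. Walks
  without steps are harmless because an admissible \<open>x\<close> is nonnegative, as one sees from small positive
  \<open>\<beta>\<close>; the limit term at \<open>\<beta> = 0\<close> plays no role.\<close>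

section \<open>Walks and the spectral radius\<close>

lemma finite_neighbors:
  assumes "pair_graph G"
  shows "finite (neighbors G i)"
proof -
  interpret pair_graph G by fact
  show ?thesis
    using pair_finite_arcs by (rule finite_surj[where f = snd]) (force simp: neighbors_def)
qed

text \<open>For a graph on \<open>{1..N}\<close> these are the row sums of the \<open>k\<close>-th
  power of the adjacency matrix.\<close>

primrec walk_count :: "nat pair_pre_digraph \<Rightarrow> nat \<Rightarrow> nat \<Rightarrow> nat" where
  "walk_count G 0 i = 1"
| "walk_count G (Suc k) i = (\<Sum>j\<in>neighbors G i. walk_count G k j)"

text \<open>The eigenvectors do not change: an eigenvalue \<open>k\<close> of the scaled matrix
  gives the eigenvalue \<open>r * k\<close> of \<open>A\<close>, so \<open>r * norm k\<close> stays
  below \<open>r\<close>.\<close>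

lemma spectral_radius_smult_less_1:
  assumes A: "A \<in> carrier_mat n n" and n: "n > 0"
    and r: "spectral_radius A < r" "r > 0"
  shows "spectral_radius (complex_of_real (1 / r) \<cdot>\<^sub>m A) < 1"
proof -
  let ?c = "complex_of_real (1 / r)"
  have B: "?c \<cdot>\<^sub>m A \<in> carrier_mat n n" using A by simp
  obtain k where k: "eigenvalue (?c \<cdot>\<^sub>m A) k" "spectral_radius (?c \<cdot>\<^sub>m A) = norm k"
    using spectral_radius_mem_max(1)[OF B n] by (auto simp: spectrum_def)
  then obtain v where v: "v \<in> carrier_vec n" "v \<noteq> 0\<^sub>v n" "(?c \<cdot>\<^sub>m A) *\<^sub>v v = k \<cdot>\<^sub>v v"
    using A by (auto simp: eigenvalue_def eigenvector_def)
  have "A *\<^sub>v v = complex_of_real r \<cdot>\<^sub>v (?c \<cdot>\<^sub>v (A *\<^sub>v v))"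
    using A v r by (simp add: smult_smult_assoc flip: of_real_mult)
  also have "?c \<cdot>\<^sub>v (A *\<^sub>v v) = k \<cdot>\<^sub>v v"
    unfolding v(3)[symmetric]
    using v(1) A by (intro eq_vecI) (auto simp: scalar_prod_def sum_distrib_left mult.assoc)
  finally have "eigenvalue A (complex_of_real r * k)"
    using v A by (auto simp: eigenvalue_def eigenvector_def smult_smult_assoc)
  hence "norm (complex_of_real r * k) \<le> spectral_radius A"
    by (intro spectral_radius_mem_max(2)[OF A n]) (auto simp: spectrum_def)
  hence "r * norm k \<le> spectral_radius A" using r(2) by (simp add: norm_mult)
  hence "r * norm k < r * 1" using r(1) by linarith
  thus ?thesis unfolding k(2) using r(2) by (rule mult_left_less_imp_less[OF _ less_imp_le])
qed

text \<open>After division by \<open>r\<close> the spectral radius is below 1, and the Jordan normal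
  form then bounds the entries of all powers by one constant. The walk counts are
  \<open>r ^ k\<close> times column sums of these powers. Taking \<open>r\<close> strictly above the
  spectral radius leaves no polynomial factor in \<open>k\<close>.\<close>

lemma walk_count_bound:
  assumes G: "pair_graph G" "pverts G = {1..N}" and N: "N > 0"
    and r: "spectral_radius (adjacency_matrix G N) < r" "r > 0"
  obtains C where "\<And>k i. i \<in> pverts G \<Longrightarrow> real (walk_count G k i) \<le> C * r ^ k"
proof -
  interpret pair_graph G by fact
  define B where "B = complex_of_real (1 / r) \<cdot>\<^sub>m adjacency_matrix G N"
  have A: "adjacency_matrix G N \<in> carrier_mat N N" by (simp add: adjacency_matrix_def)
  have B: "B \<in> carrier_mat N N" using A by (simp add: B_def)
  have Bk: "B ^\<^sub>m k \<in> carrier_mat N N" for k using B by simp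
  obtain c where c: "\<And>k. norm_bound (B ^\<^sub>m k) c"
    using spectral_radius_jnf_norm_bound_less_1_upper_triangular[OF B]
      spectral_radius_smult_less_1[OF A N r] unfolding B_def by blast
  \<comment> \<open>Symmetry of the arcs lets the neighbors be read off column \<open>j\<close>;
    \<open>Suc\<close> turns matrix indices into vertices.\<close>
  have nb: "neighbors G (Suc j) = Suc ` {l. l < N \<and> (Suc l, Suc j) \<in> parcs G}" for j
  proof -
    have "l \<in> {1..N}" "(l, Suc j) \<in> parcs G" if "(Suc j, l) \<in> parcs G" for l
      using that in_arcsD2 arc_snd_in_verts[OF that] G(2) pair_sym_arcs
      by (auto simp: symmetric_def sym_def)
    moreover have "(Suc j, l) \<in> parcs G" if "(l, Suc j) \<in> parcs G" for l
      using that pair_sym_arcs by (auto simp: symmetric_def sym_def)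
    ultimately show ?thesis
      by (auto simp: neighbors_def image_iff) (metis Suc_le_D Suc_le_lessD Suc_le_mono One_nat_def atLeastAtMost_iff)
  qed
  \<comment> \<open>Matrix powers unfold on the right, so the first step of a walk is the last
    factor; this is why columns and not rows are summed.\<close>
  have eq: "of_nat (walk_count G k (Suc j)) = of_real r ^ k * (\<Sum>i<N. (B ^\<^sub>m k) $$ (i, j))"
    if "j < N" for k j
    using that
  proof (induction k arbitrary: j)
    case 0
    have "(\<Sum>i<N. (B ^\<^sub>m 0) $$ (i, j)) = (\<Sum>i<N. if i = j then 1 else 0)"
      using 0 B by (intro sum.cong) auto
    with 0 show ?case by simp
  next
    case (Suc k)
    have "of_nat (walk_count G (Suc k) (Suc j)) =
        (\<Sum>l<N. if (Suc l, Suc j) \<in> parcs G then of_nat (walk_count G k (Suc l)) else (0::complex))"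
      by (auto simp: nb sum.reindex intro!: sum.mono_neutral_cong_left split: if_splits)
    also have "\<dots> = (\<Sum>l<N. of_real r ^ Suc k * ((\<Sum>i<N. (B ^\<^sub>m k) $$ (i, l)) * B $$ (l, j)))"
      using Suc r by (intro sum.cong) (auto simp: B_def adjacency_matrix_def)
    also have "\<dots> = of_real r ^ Suc k * (\<Sum>l<N. \<Sum>i<N. (B ^\<^sub>m k) $$ (i, l) * B $$ (l, j))"
      by (simp add: sum_distrib_left sum_distrib_right)
    also have "(\<Sum>l<N. \<Sum>i<N. (B ^\<^sub>m k) $$ (i, l) * B $$ (l, j)) =
        (\<Sum>i<N. \<Sum>l<N. (B ^\<^sub>m k) $$ (i, l) * B $$ (l, j))"
      by (rule sum.swap)
    also have "\<dots> = (\<Sum>i<N. (B ^\<^sub>m Suc k) $$ (i, j))"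
      using Suc.prems Bk B by (intro sum.cong) (auto simp: scalar_prod_def atLeast0LessThan)
    finally show ?case .
  qed
  show ?thesis
  proof
    fix k i assume "i \<in> pverts G"
    then obtain j where j: "i = Suc j" "j < N" using G(2) by (cases i) auto
    have "real (walk_count G k i) = norm (of_nat (walk_count G k i) :: complex)" by simp
    also have "\<dots> = r ^ k * norm (\<Sum>i<N. (B ^\<^sub>m k) $$ (i, j))"
      using eq[OF j(2), of k] r j(1) by (simp add: norm_mult norm_power)
    also have "norm (\<Sum>i<N. (B ^\<^sub>m k) $$ (i, j)) \<le> (\<Sum>i<N. c)"
      using c[of k] Bk[of k] B j by (intro sum_norm_le) (auto simp: norm_bound_def)
    finally show "real (walk_count G k i) \<le> (real N * c) * r ^ k"
      using r by (simp add: mult.commute mult_left_mono)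
  qed
qed

text \<open>Reachability between distinct vertices passes through at least one arc of the symmetric
  closure, which stems from an arc of \<open>G\<close>.\<close>

lemma connected_graph_has_arc:
  assumes G: "pair_graph G" "Digraph_Component.connected (with_proj G)"
    and uv: "u \<in> pverts G" "v \<in> pverts G" "u \<noteq> v"
  obtains i j where "(i, j) \<in> parcs G"
proof -
  interpret pair_graph G by fact
  have "u \<rightarrow>\<^sup>*\<^bsub>with_proj (mk_symmetric (with_proj G))\<^esub> v"
    using G(2) uv unfolding Digraph_Component.connected_def strongly_connected_def by auto
  hence "parcs (mk_symmetric (with_proj G)) \<noteq> {}"
    using uv(3) by (auto simp: reachable_def elim: rtrancl_on.cases)
  thus ?thesis using that by (auto simp: mk_symmetric_def)
qed

text \<open>Going back and forth along one edge gives walks of every length, so the walk counts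
  never drop below 1. If the spectral radius were not positive, they would be at most
  \<open>C * (1/2) ^ k\<close>, which tends to 0. Positivity makes
  \<open>ln (\<rho> * (1 - p))\<close> a genuine logarithm.\<close>

lemma spectral_radius_adjacency_pos:
  assumes G: "pair_graph G" "pverts G = {1..N}" and arc: "(i, j) \<in> parcs G"
  shows "spectral_radius (adjacency_matrix G N) > 0"
proof (rule ccontr)
  interpret pair_graph G by fact
  have ij: "i \<in> pverts G" "j \<in> pverts G"
    using arc arc_fst_in_verts[OF arc] arc_snd_in_verts[OF arc] by auto
  have sym: "(j, i) \<in> parcs G" using arc pair_sym_arcs by (auto simp: symmetric_def sym_def)
  have fin: "finite (neighbors G u)" for u
    by (rule finite_neighbors[OF G(1)])
  have ge: "walk_count G k i \<ge> 1 \<and> walk_count G k j \<ge> 1" for k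
  proof (induction k)
    case (Suc k)
    have "walk_count G (Suc k) i \<ge> walk_count G k j"
      using arc fin[of i] by (auto simp: neighbors_def intro!: member_le_sum)
    moreover have "walk_count G (Suc k) j \<ge> walk_count G k i"
      using sym fin[of j] by (auto simp: neighbors_def intro!: member_le_sum)
    ultimately show ?case using Suc by linarith
  qed auto
  assume "\<not> ?thesis"
  hence r: "spectral_radius (adjacency_matrix G N) < 1/2" by simp
  obtain C where C: "\<And>k i. i \<in> pverts G \<Longrightarrow> real (walk_count G k i) \<le> C * (1/2) ^ k"
    using walk_count_bound[OF G _ r] ij(1) G(2) by auto
  have "(\<lambda>k. C * (1/2) ^ k) \<longlonglongrightarrow> C * 0" by (intro tendsto_intros) auto
  moreover have "C * (1/2) ^ k \<ge> 1" for k
    using C[OF ij(1), of k] ge[of k] by linarith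
  ultimately have "(1::real) \<le> C * 0" by (intro LIMSEQ_le_const) auto
  thus False by simp
qed

section \<open>Exponential sums over lazy walks\<close>

text \<open>For \<open>\<gamma> > 0\<close> this is the exponential of \<open>\<gamma>\<close> times
  the link weight, a deleted link giving exp(-\<infinity>) = 0. Values in \<open>ennreal\<close>
  allow expectations without integrability conditions.\<close>

definition exp_weight ::
    "(nat \<times> nat \<Rightarrow> nat \<Rightarrow> 'w \<Rightarrow> bool) \<Rightarrow> (nat \<times> nat \<Rightarrow> nat \<Rightarrow> 'w \<Rightarrow> real) \<Rightarrow>
     real \<Rightarrow> 'w \<Rightarrow> nat \<times> nat \<Rightarrow> nat \<Rightarrow> ennreal" where
  "exp_weight absent v \<gamma> \<omega> a t = (if absent a t \<omega> then 0 else ennreal (exp (\<gamma> * v a t \<omega>)))"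

text \<open>Partition function of the lazy walks of length \<open>t\<close> from \<open>i\<close>
  with exactly \<open>k\<close> moves: each walk contributes the product of the weights of its
  moves. Time runs backwards along the walk, as in the unfolded recursion, so the latest time
  belongs to the step out of \<open>i\<close>.\<close>

primrec lazy_walk_sum ::
    "nat pair_pre_digraph \<Rightarrow> (nat \<times> nat \<Rightarrow> nat \<Rightarrow> ennreal) \<Rightarrow> nat \<Rightarrow> nat \<Rightarrow> nat \<Rightarrow> ennreal" where
  "lazy_walk_sum G W 0 k i = (if k = 0 then 1 else 0)"
| "lazy_walk_sum G W (Suc t) k i = lazy_walk_sum G W t k i +
     (case k of 0 \<Rightarrow> 0 | Suc l \<Rightarrow> (\<Sum>j\<in>neighbors G i. lazy_walk_sum G W t l j * W (i, j) t))"

lemma lazy_walk_sum_0 [simp]: "lazy_walk_sum G W t 0 i = 1"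
  by (induction t) auto

text \<open>A finite nonempty supremum is attained, and the term of a deleted link is
  \<open>-\<infinity>\<close>, which cannot beat the current state.\<close>

lemma consensus_state_Suc_cases:
  fixes absent v \<omega> x0 t i
  assumes fin: "finite (neighbors G i)"
  defines "x \<equiv> consensus_state G (link_weight absent v \<omega>) x0"
  shows "x (Suc t) i = x t i \<or>
    (\<exists>j\<in>neighbors G i. \<not> absent (i, j) t \<omega> \<and> x (Suc t) i = x t j + v (i, j) t \<omega>)"
proof -
  let ?f = "\<lambda>j. ereal (x t j) + link_weight absent v \<omega> (i, j) t"
  let ?S = "SUP j\<in>neighbors G i. ?f j"
  have eq: "x (Suc t) i = real_of_ereal (max (ereal (x t i)) ?S)" by (simp add: x_def)
  show ?thesis
  proof (cases "?S \<le> ereal (x t i)")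
    case True
    thus ?thesis using eq by (simp add: max_absorb1)
  next
    case False
    \<comment> \<open>Over no neighbors the supremum is \<open>-\<infinity>\<close>, which lies
      below the current state.\<close>
    hence ne: "neighbors G i \<noteq> {}" by (auto simp: bot_ereal_def)
    have "?S = Max (?f ` neighbors G i)" using fin ne by (intro Max_Sup[symmetric]) auto
    also have "\<dots> \<in> ?f ` neighbors G i" using fin ne by (intro Max_in) auto
    finally obtain j where j: "j \<in> neighbors G i" "?S = ?f j" by auto
    with False have "\<not> absent (i, j) t \<omega>" by (auto simp: link_weight_def)
    with j False eq show ?thesis by (auto simp: link_weight_def max_def)
  qed
qed

text \<open>Following the maximizers back in time gives one lazy walk whose weight plus an initial
  value is the state, and its term alone is a lower bound of the sum. The number \<open>k\<close> of
  moves is fixed before \<open>\<gamma>\<close>, so that the Chernoff parameter may later depend on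
  \<open>k\<close>.\<close>

lemma exp_consensus_state_le_lazy_walk_sum:
  fixes G absent v \<omega> x0
  assumes fin: "\<And>i. finite (neighbors G i)"
    and closed: "\<And>i. i \<in> V \<Longrightarrow> neighbors G i \<subseteq> V"
    and c: "\<And>i. i \<in> V \<Longrightarrow> x0 i \<le> c" and i: "i \<in> V"
  defines "x \<equiv> consensus_state G (link_weight absent v \<omega>) x0"
  shows "\<exists>k\<le>t. \<forall>\<gamma>\<ge>0. ennreal (exp (\<gamma> * (x t i - c))) \<le>
    lazy_walk_sum G (exp_weight absent v \<gamma> \<omega>) t k i"
  using i
proof (induction t arbitrary: i)
  case 0
  thus ?case using c by (auto simp: x_def mult_nonneg_nonpos simp flip: ennreal_1 intro!: ennreal_leI)
next
  case (Suc t)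
  consider (stay) "x (Suc t) i = x t i"
    | (move) j where "j \<in> neighbors G i" "\<not> absent (i, j) t \<omega>" "x (Suc t) i = x t j + v (i, j) t \<omega>"
    using consensus_state_Suc_cases[OF fin, of absent v \<omega> x0 t i] unfolding x_def by blast
  thus ?case
  proof cases
    case stay
    then obtain k where "k \<le> t" and k: "\<And>\<gamma>. \<gamma> \<ge> 0 \<Longrightarrow> ennreal (exp (\<gamma> * (x (Suc t) i - c))) \<le>
        lazy_walk_sum G (exp_weight absent v \<gamma> \<omega>) t k i"
      using Suc.IH[OF Suc.prems] by auto
    thus ?thesis
      by (intro exI[of _ k]) (auto intro!: order_trans[OF k])
  next
    case move
    then obtain k where "k \<le> t" and k: "\<And>\<gamma>. \<gamma> \<ge> 0 \<Longrightarrow> ennreal (exp (\<gamma> * (x t j - c))) \<le>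
        lazy_walk_sum G (exp_weight absent v \<gamma> \<omega>) t k j"
      using Suc.IH[of j] closed[OF Suc.prems] by blast
    have "ennreal (exp (\<gamma> * (x (Suc t) i - c))) \<le>
        lazy_walk_sum G (exp_weight absent v \<gamma> \<omega>) (Suc t) (Suc k) i" if "\<gamma> \<ge> 0" for \<gamma>
    proof -
      let ?W = "exp_weight absent v \<gamma> \<omega>"
      have "ennreal (exp (\<gamma> * (x (Suc t) i - c))) = ennreal (exp (\<gamma> * (x t j - c))) * ?W (i, j) t"
        using move by (simp add: exp_weight_def algebra_simps flip: ennreal_mult exp_add)
      also have "\<dots> \<le> lazy_walk_sum G ?W t k j * ?W (i, j) t"
        by (intro mult_right_mono k that) auto
      also have "\<dots> \<le> (\<Sum>j\<in>neighbors G i. lazy_walk_sum G ?W t k j * ?W (i, j) t)"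
        using fin move(1) by (intro member_le_sum) auto
      also have "\<dots> \<le> lazy_walk_sum G ?W (Suc t) (Suc k) i" by simp
      finally show ?thesis .
    qed
    with \<open>k \<le> t\<close> show ?thesis by (intro exI[of _ "Suc k"]) auto
  qed
qed

section \<open>Expectations of lazy walk sums\<close>

context prob_space
begin

text \<open>There is one arc per time in \<open>T\<close>, so distinct members use distinct pairs of
  an undirected edge and a time. Independence across these pairs suffices, whatever the joint law of
  the two directions of an edge.\<close>

lemma prob_all_present:
  assumes del: "random_deletions M G p absent"
    and G: "pair_graph G"
    and T: "finite T" and a: "\<And>s. s \<in> T \<Longrightarrow> a s \<in> parcs G"
  shows "prob {\<omega> \<in> space M. \<forall>s\<in>T. \<not> absent (a s) s \<omega>} = (1 - p) ^ card T"
proof (cases "T = {}")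
  \<comment> \<open>Treated apart because an empty intersection would be \<open>UNIV\<close> instead
    of the sample space.\<close>
  case True
  thus ?thesis by (simp add: prob_space)
next
  case False
  interpret pair_graph G by fact
  let ?X = "\<lambda>((i, j), t) \<omega>. (absent (i, j) t \<omega>, absent (j, i) t \<omega>)"
  let ?I = "{(i, j) \<in> parcs G. i < j} \<times> (UNIV :: nat set)"
  have ind: "indep_vars (\<lambda>_. count_space UNIV) ?X ?I"
    and pr: "\<And>a t. a \<in> parcs G \<Longrightarrow> prob {\<omega> \<in> space M. absent a t \<omega>} = p"
    using del by (auto simp: random_deletions_def)
  \<comment> \<open>\<open>e s\<close> is the index with the smaller endpoint first;
    \<open>A\<close> asks that the component belonging to the direction of \<open>a s\<close> be
    false.\<close>
  define e where "e s = (if fst (a s) < snd (a s) then (a s, s) else (prod.swap (a s), s))" for s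
  define A where "A = (\<lambda>(_ :: nat \<times> nat, s). if fst (a s) < snd (a s) then {b :: bool \<times> bool. \<not> fst b} else {b. \<not> snd b})"
  have inj: "inj_on e T" by (auto simp: inj_on_def e_def split: if_splits)
  have sym: "(j, i) \<in> parcs G" if "(i, j) \<in> parcs G" for i j
    using that pair_sym_arcs by (auto simp: symmetric_def sym_def)
  have eI: "e s \<in> ?I" if "s \<in> T" for s
    using a[OF that] sym pair_no_loops[OF a[OF that]]
    by (cases "a s") (auto simp: e_def)
  have ev: "?X (e s) -` A (e s) \<inter> space M = {\<omega> \<in> space M. \<not> absent (a s) s \<omega>}" for s
    by (cases "a s") (auto simp: e_def A_def)
  have pe: "prob (?X (e s) -` A (e s) \<inter> space M) = 1 - p" if "s \<in> T" for s
  proof -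
    have "\<forall>i\<in>?I. ?X i \<in> measurable M (count_space UNIV)"
      using ind unfolding indep_vars_def by (rule conjunct1)
    hence "?X (e s) \<in> measurable M (count_space UNIV)"
      using eI[OF that] by (rule bspec)
    hence "{\<omega> \<in> space M. \<not> absent (a s) s \<omega>} \<in> events"
      unfolding ev[symmetric] by (rule measurable_sets) auto
    from prob_compl[OF this] have "prob (space M - {\<omega> \<in> space M. \<not> absent (a s) s \<omega>}) =
        1 - prob {\<omega> \<in> space M. \<not> absent (a s) s \<omega>}" .
    also have "space M - {\<omega> \<in> space M. \<not> absent (a s) s \<omega>} = {\<omega> \<in> space M. absent (a s) s \<omega>}"
      by auto
    finally have "prob {\<omega> \<in> space M. absent (a s) s \<omega>} =
        1 - prob {\<omega> \<in> space M. \<not> absent (a s) s \<omega>}" .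
    thus ?thesis unfolding ev using pr[OF a[OF that], of s] by simp
  qed
  have "prob (\<Inter>i\<in>e ` T. ?X i -` A i \<inter> space M) = (\<Prod>i\<in>e ` T. prob (?X i -` A i \<inter> space M))"
    using False T image_subsetI[of T e, OF eI]
    by (intro indep_varsD[OF ind]) (simp_all add: A_def case_prod_unfold)
  also have "\<dots> = (\<Prod>s\<in>T. 1 - p)"
    by (subst prod.reindex[OF inj]) (auto simp only: o_def pe intro!: prod.cong)
  also have "(\<Inter>i\<in>e ` T. ?X i -` A i \<inter> space M) = {\<omega> \<in> space M. \<forall>s\<in>T. \<not> absent (a s) s \<omega>}"
    unfolding image_image using False by (subst ev) auto
  finally show ?thesis by simp
qed

lemma nn_integral_prod_exp_noise:
  assumes noise: "iid_noise M G \<mu> v"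
    and T: "finite T" and a: "\<And>s. s \<in> T \<Longrightarrow> a s \<in> parcs G"
  shows "(\<integral>\<^sup>+\<omega>. (\<Prod>s\<in>T. ennreal (exp (\<gamma> * v (a s) s \<omega>))) \<partial>M) = mgf \<mu> \<gamma> ^ card T"
proof -
  let ?I = "(\<lambda>s. (a s, s)) ` T"
  let ?Y = "\<lambda>(a, s) \<omega>. ennreal (exp (\<gamma> * v a s \<omega>))"
  have ind: "indep_vars (\<lambda>_. borel) (\<lambda>(a, t). v a t) (parcs G \<times> UNIV)"
    and d: "\<And>a t. a \<in> parcs G \<Longrightarrow> distr M borel (v a t) = \<mu>"
    using noise by (auto simp: iid_noise_def)
  have inj: "inj_on (\<lambda>s. (a s, s)) T" by (auto simp: inj_on_def)
  have "indep_vars (\<lambda>_. borel) (\<lambda>(a, t). v a t) ?I"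
    by (rule indep_vars_subset[OF ind]) (use a in auto)
  hence "indep_vars (\<lambda>_. borel) (\<lambda>i \<omega>. ennreal (exp (\<gamma> * (case i of (a, t) \<Rightarrow> v a t) \<omega>))) ?I"
    by (rule indep_vars_compose2) auto
  hence "indep_vars (\<lambda>_. borel) ?Y ?I"
    by (simp add: case_prod_unfold)
  hence "(\<integral>\<^sup>+\<omega>. (\<Prod>i\<in>?I. ?Y i \<omega>) \<partial>M) = (\<Prod>i\<in>?I. \<integral>\<^sup>+\<omega>. ?Y i \<omega> \<partial>M)"
    using T by (intro indep_vars_nn_integral) auto
  moreover have "(\<integral>\<^sup>+\<omega>. ennreal (exp (\<gamma> * v (a s) s \<omega>)) \<partial>M) = mgf \<mu> \<gamma>" if "s \<in> T" for s
  proof -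
    have "random_variable borel (v (a s) s)" using ind a[OF that] by (auto simp: indep_vars_def)
    thus ?thesis unfolding mgf_def d[OF a[OF that], of s, symmetric] by (subst nn_integral_distr) auto
  qed
  ultimately show ?thesis by (simp add: prod.reindex[OF inj])
qed

text \<open>The product splits into the indicator that all arcs are present and the product of the
  noise exponentials. The first is measurable for the deletions alone and the second for the noise
  alone, so the expectation factors.\<close>

lemma nn_integral_prod_exp_weight:
  assumes del: "random_deletions M G p absent" and noise: "iid_noise M G \<mu> v"
    and indep: "deletions_indep_noise M G absent v"
    and G: "pair_graph G"
    and T: "finite T" and a: "\<And>s. s \<in> T \<Longrightarrow> a s \<in> parcs G"
  shows "(\<integral>\<^sup>+\<omega>. (\<Prod>s\<in>T. exp_weight absent v \<gamma> \<omega> (a s) s) \<partial>M) =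
    (ennreal (1 - p) * mgf \<mu> \<gamma>) ^ card T"
proof -
  define VA where "VA = vimage_algebra (space M) (\<lambda>\<omega>. \<lambda>(a, t) \<in> parcs G \<times> UNIV. absent a t \<omega>)
          (PiM (parcs G \<times> UNIV) (\<lambda>_. count_space UNIV))"
  define VN where "VN = vimage_algebra (space M) (\<lambda>\<omega>. \<lambda>(a, t) \<in> parcs G \<times> UNIV. v a t \<omega>)
          (PiM (parcs G \<times> UNIV) (\<lambda>_. borel :: real measure))"
  have ind: "indep_set (sets VA) (sets VN)"
    using indep by (simp add: deletions_indep_noise_def VA_def VN_def)
  have [simp]: "space VA = space M" "space VN = space M" by (simp_all add: VA_def VN_def)
  have mA: "absent (a s) s \<in> measurable VA (count_space UNIV)" if "s \<in> T" for s
  proof -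
    have "(\<lambda>\<omega>. \<lambda>(a, t) \<in> parcs G \<times> UNIV. absent a t \<omega>) \<in>
        measurable VA (PiM (parcs G \<times> UNIV) (\<lambda>_. count_space UNIV))"
      unfolding VA_def by (rule measurable_vimage_algebra1) (auto simp: space_PiM)
    from measurable_compose[OF this measurable_component_singleton, of "(a s, s)"]
    show ?thesis using a[OF that] by simp
  qed
  have mN: "v (a s) s \<in> borel_measurable VN" if "s \<in> T" for s
  proof -
    have "(\<lambda>\<omega>. \<lambda>(a, t) \<in> parcs G \<times> UNIV. v a t \<omega>) \<in>
        measurable VN (PiM (parcs G \<times> UNIV) (\<lambda>_. borel))"
      unfolding VN_def by (rule measurable_vimage_algebra1) (auto simp: space_PiM)
    from measurable_compose[OF this measurable_component_singleton, of "(a s, s)"]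
    show ?thesis using a[OF that] by simp
  qed
  define B where "B = {\<omega> \<in> space M. \<forall>s\<in>T. \<not> absent (a s) s \<omega>}"
  define X :: "'a \<Rightarrow> ennreal" where "X = indicator B"
  define Y where "Y \<omega> = (\<Prod>s\<in>T. ennreal (exp (\<gamma> * v (a s) s \<omega>)))" for \<omega>
  have "{\<omega> \<in> space VA. \<forall>s\<in>T. \<not> absent (a s) s \<omega>} \<in> sets VA"
    using T mA by measurable
  hence BA: "B \<in> sets VA" by (simp add: B_def)
  have XA: "X \<in> borel_measurable VA" unfolding X_def using BA by simp
  have YN: "Y \<in> borel_measurable VN" unfolding Y_def using T mN by measurable
  have sub: "sets VA \<subseteq> events" "sets VN \<subseteq> events" using ind by (auto simp: indep_sets2_eq)
  have XM: "X \<in> borel_measurable M" and YM: "Y \<in> borel_measurable M"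
    using measurable_mono[of borel borel VA M] measurable_mono[of borel borel VN M] sub XA YN by auto
  have "indep_var borel X borel Y"
    unfolding indep_var_eq
  proof (intro conjI XM YM)
    \<comment> \<open>Independence passes from \<open>VA\<close> and \<open>VN\<close> to the
      smaller sigma-algebras generated by \<open>X\<close> and \<open>Y\<close>.\<close>
    have sX: "sigma_sets (space M) {X -` A \<inter> space M |A. A \<in> sets borel} \<subseteq> sets VA"
      using sets.sigma_sets_subset[of "{X -` A \<inter> space M |A. A \<in> sets borel}" VA]
        measurable_sets[OF XA] by auto
    have sY: "sigma_sets (space M) {Y -` A \<inter> space M |A. A \<in> sets borel} \<subseteq> sets VN"
      using sets.sigma_sets_subset[of "{Y -` A \<inter> space M |A. A \<in> sets borel}" VN]
        measurable_sets[OF YN] by auto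
    show "indep_set (sigma_sets (space M) {X -` A \<inter> space M |A. A \<in> sets borel})
       (sigma_sets (space M) {Y -` A \<inter> space M |A. A \<in> sets borel})"
      using ind sX sY unfolding indep_sets2_eq by blast
  qed
  \<comment> \<open>The product formula for integrals is about families, hence the pair is indexed
    by \<open>bool\<close>.\<close>
  hence "indep_vars (\<lambda>_. borel) (case_bool X Y) UNIV"
    by (simp add: indep_var_def case_bool_if if_distrib cong: if_cong)
  from indep_vars_nn_integral[OF _ this]
  have "(\<integral>\<^sup>+\<omega>. X \<omega> * Y \<omega> \<partial>M) = (\<integral>\<^sup>+\<omega>. X \<omega> \<partial>M) * (\<integral>\<^sup>+\<omega>. Y \<omega> \<partial>M)"
    by (simp add: UNIV_bool mult.commute)
  also have "(\<integral>\<^sup>+\<omega>. X \<omega> \<partial>M) = ennreal (1 - p) ^ card T"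
  proof -
    have "(\<integral>\<^sup>+\<omega>. X \<omega> \<partial>M) = ennreal (prob B)"
      unfolding X_def using BA sub by (subst nn_integral_indicator) (auto simp: emeasure_eq_measure)
    also have "\<dots> = ennreal ((1 - p) ^ card T)"
      unfolding B_def using prob_all_present[OF del G T a] by simp
    also have "\<dots> = ennreal (1 - p) ^ card T"
    \<comment> \<open>Pulling the power out of \<open>ennreal\<close> uses \<open>p \<le> 1\<close>,
      which follows from \<open>p\<close> being the probability of an event as soon as
      \<open>T\<close> has an element.\<close>
    proof (cases "T = {}")
      case False
      then obtain s where "s \<in> T" by auto
      hence "p = prob {\<omega> \<in> space M. absent (a s) s \<omega>}"
        using del a by (auto simp: random_deletions_def)
      hence "p \<le> 1" by simp
      thus ?thesis by (simp add: ennreal_power)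
    qed auto
    finally show ?thesis .
  qed
  also have "(\<integral>\<^sup>+\<omega>. Y \<omega> \<partial>M) = mgf \<mu> \<gamma> ^ card T"
    unfolding Y_def by (rule nn_integral_prod_exp_noise[OF noise T a])
  also have "(\<integral>\<^sup>+\<omega>. X \<omega> * Y \<omega> \<partial>M) = (\<integral>\<^sup>+\<omega>. (\<Prod>s\<in>T. exp_weight absent v \<gamma> \<omega> (a s) s) \<partial>M)"
  proof (rule nn_integral_cong)
    fix \<omega> assume "\<omega> \<in> space M"
    show "X \<omega> * Y \<omega> = (\<Prod>s\<in>T. exp_weight absent v \<gamma> \<omega> (a s) s)"
    proof (cases "\<omega> \<in> B")
      case True
      thus ?thesis by (auto simp: X_def Y_def B_def exp_weight_def intro!: prod.cong)
    next
      case False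
      with \<open>\<omega> \<in> space M\<close> obtain s where "s \<in> T" "exp_weight absent v \<gamma> \<omega> (a s) s = 0"
        by (auto simp: B_def exp_weight_def)
      hence "(\<Prod>s\<in>T. exp_weight absent v \<gamma> \<omega> (a s) s) = 0" using T by (intro prod_zero) auto
      with False show ?thesis by (simp add: X_def)
    qed
  qed
  finally show ?thesis by (simp add: power_mult_distrib)
qed

lemma measurable_exp_weight:
  assumes del: "random_deletions M G p absent" and noise: "iid_noise M G \<mu> v"
    and G: "pair_graph G" and a: "a \<in> parcs G"
  shows "(\<lambda>\<omega>. exp_weight absent v \<gamma> \<omega> a t) \<in> borel_measurable M"
proof -
  interpret pair_graph G by fact
  obtain i j where ij: "a = (i, j)" by force
  \<comment> \<open>Only pairs with the smaller vertex first index the independent family, so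
    measurability of \<open>absent a t\<close> is read from a component of such a pair.\<close>
  define b where "b = (if i < j then (i, j) else (j, i))"
  have "i \<noteq> j" "(j, i) \<in> parcs G" using pair_no_loops[OF a] a pair_sym_arcs ij
    by (auto simp: symmetric_def sym_def)
  hence b: "(b, t) \<in> {(i, j) \<in> parcs G. i < j} \<times> UNIV" using a ij by (auto simp: b_def)
  let ?X = "\<lambda>((i, j), t) \<omega>. (absent (i, j) t \<omega>, absent (j, i) t \<omega>)"
  have "\<forall>i\<in>{(i, j) \<in> parcs G. i < j} \<times> UNIV. ?X i \<in> measurable M (count_space UNIV)"
    using del unfolding random_deletions_def indep_vars_def by (elim conjE)
  hence "?X (b, t) \<in> measurable M (count_space UNIV)"
    using b by (rule bspec)
  from measurable_compose[OF this, of "if i < j then fst else snd" "count_space UNIV"]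
  have [measurable]: "Measurable.pred M (absent a t)"
    using \<open>i \<noteq> j\<close> by (auto simp: b_def ij split: if_splits)
  have [measurable]: "v a t \<in> borel_measurable M"
    using noise a by (auto simp: iid_noise_def indep_vars_def)
  show ?thesis unfolding exp_weight_def by measurable
qed

lemma measurable_lazy_walk_sum:
  assumes del: "random_deletions M G p absent" and noise: "iid_noise M G \<mu> v"
    and G: "pair_graph G"
  shows "(\<lambda>\<omega>. lazy_walk_sum G (exp_weight absent v \<gamma> \<omega>) t k i) \<in> borel_measurable M"
proof (induction t arbitrary: k i)
  case (Suc t)
  have "(\<lambda>\<omega>. exp_weight absent v \<gamma> \<omega> (i, j) t) \<in> borel_measurable M" if "j \<in> neighbors G i" for j
    using that by (intro measurable_exp_weight[OF del noise G]) (simp add: neighbors_def)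
  with Suc show ?case
    by (cases k) (auto intro!: borel_measurable_sum borel_measurable_add borel_measurable_times)
qed auto

text \<open>The extra factor, indexed by times not before \<open>t\<close>, makes the induction go through: each
  step of a walk is moved into it, so that independence is only used for products of weights at
  distinct times.\<close>

lemma nn_integral_lazy_walk_sum_prod:
  fixes \<mu> p \<gamma>
  assumes del: "random_deletions M G p absent" and noise: "iid_noise M G \<mu> v"
    and indep: "deletions_indep_noise M G absent v" and G: "pair_graph G"
    and T: "finite T" "\<And>s. s \<in> T \<Longrightarrow> t \<le> s" and a: "\<And>s. s \<in> T \<Longrightarrow> a s \<in> parcs G"
  defines "q \<equiv> ennreal (1 - p) * mgf \<mu> \<gamma>"
  shows "(\<integral>\<^sup>+\<omega>. lazy_walk_sum G (exp_weight absent v \<gamma> \<omega>) t k i *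
      (\<Prod>s\<in>T. exp_weight absent v \<gamma> \<omega> (a s) s) \<partial>M) =
    of_nat (t choose k) * of_nat (walk_count G k i) * q ^ (k + card T)"
  using T a
proof (induction t arbitrary: k i T a)
  case 0
  thus ?case using nn_integral_prod_exp_weight[OF del noise indep G, of T a \<gamma>]
    by (cases k) (simp_all add: q_def)
next
  case (Suc t)
  interpret pair_graph G by fact
  let ?W = "exp_weight absent v \<gamma>"
  let ?U = "\<lambda>\<omega>. lazy_walk_sum G (?W \<omega>)"
  let ?Pr = "\<lambda>\<omega>. \<Prod>s\<in>T. ?W \<omega> (a s) s"
  have T: "\<And>s. s \<in> T \<Longrightarrow> t \<le> s" using Suc.prems(2) by fastforce
  \<comment> \<open>All times in \<open>T\<close> are at least \<open>Suc t\<close>, so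
    \<open>t\<close> is a new index when a move at time \<open>t\<close> joins the product.\<close>
  have tT: "t \<notin> T" using Suc.prems(2) by fastforce
  note mU [measurable] = measurable_lazy_walk_sum[OF del noise G, of \<gamma>]
  have mP [measurable]: "?Pr \<in> borel_measurable M"
  proof -
    have [measurable]: "(\<lambda>\<omega>. ?W \<omega> (a s) s) \<in> borel_measurable M" if "s \<in> T" for s
      by (rule measurable_exp_weight[OF del noise G Suc.prems(3)[OF that]])
    show ?thesis by measurable
  qed
  have stay: "(\<integral>\<^sup>+\<omega>. ?U \<omega> t k i * ?Pr \<omega> \<partial>M) =
      of_nat (t choose k) * of_nat (walk_count G k i) * q ^ (k + card T)"
    using Suc.IH[OF Suc.prems(1) T Suc.prems(3)] by simp
  show ?case
  proof (cases k)
    case 0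
    thus ?thesis using stay by simp
  next
    case (Suc l)
    have fin: "finite (neighbors G i)"
      by (rule finite_neighbors[OF G])
    \<comment> \<open>The move to \<open>j\<close> is shifted into the extra factor:
      \<open>k\<close> drops to \<open>l\<close> while the index set gains \<open>t\<close>, so the
      exponent of \<open>q\<close> stays \<open>k + card T\<close>.\<close>
    have move: "(\<integral>\<^sup>+\<omega>. ?U \<omega> t l j * ?W \<omega> (i, j) t * ?Pr \<omega> \<partial>M) =
        of_nat (t choose l) * of_nat (walk_count G l j) * q ^ (k + card T)"
      if "j \<in> neighbors G i" for j
    proof -
      define b where "b = a(t := (i, j))"
      have "(\<Prod>s\<in>insert t T. ?W \<omega> (b s) s) = ?W \<omega> (i, j) t * ?Pr \<omega>" for \<omega>
        using tT Suc.prems(1) by (auto simp: b_def intro!: arg_cong2[where f = "(*)"] prod.cong)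
      moreover have "(\<integral>\<^sup>+\<omega>. ?U \<omega> t l j * (\<Prod>s\<in>insert t T. ?W \<omega> (b s) s) \<partial>M) =
          of_nat (t choose l) * of_nat (walk_count G l j) * q ^ (l + card (insert t T))"
        using Suc.prems T that
        by (intro Suc.IH) (auto simp: b_def neighbors_def)
      ultimately show ?thesis using tT Suc.prems(1) \<open>k = Suc l\<close> by (simp add: mult.assoc)
    qed
    have mW: "(\<lambda>\<omega>. ?W \<omega> (i, j) t) \<in> borel_measurable M" if "j \<in> neighbors G i" for j
      using that by (intro measurable_exp_weight[OF del noise G]) (simp add: neighbors_def)
    have moves: "(\<Sum>j\<in>neighbors G i. \<integral>\<^sup>+\<omega>. ?U \<omega> t l j * ?W \<omega> (i, j) t * ?Pr \<omega> \<partial>M) =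
        of_nat (t choose l) * of_nat (walk_count G k i) * q ^ (k + card T)"
      by (simp add: move \<open>k = Suc l\<close> sum_distrib_left sum_distrib_right)
    have "(\<integral>\<^sup>+\<omega>. ?U \<omega> (Suc t) k i * ?Pr \<omega> \<partial>M) =
        (\<integral>\<^sup>+\<omega>. ?U \<omega> t k i * ?Pr \<omega> +
          (\<Sum>j\<in>neighbors G i. ?U \<omega> t l j * ?W \<omega> (i, j) t * ?Pr \<omega>) \<partial>M)"
      by (simp add: \<open>k = Suc l\<close> distrib_right sum_distrib_right)
    also have "\<dots> = (\<integral>\<^sup>+\<omega>. ?U \<omega> t k i * ?Pr \<omega> \<partial>M) +
        (\<Sum>j\<in>neighbors G i. \<integral>\<^sup>+\<omega>. ?U \<omega> t l j * ?W \<omega> (i, j) t * ?Pr \<omega> \<partial>M)"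
      using mW mU mP
      by (subst nn_integral_add)
         (auto simp: nn_integral_sum intro!: borel_measurable_sum borel_measurable_times)
    also have "\<dots> = of_nat (t choose k) * of_nat (walk_count G k i) * q ^ (k + card T) +
        of_nat (t choose l) * of_nat (walk_count G k i) * q ^ (k + card T)"
      unfolding stay moves ..
    \<comment> \<open>Staying and moving combine by Pascal's rule.\<close>
    also have "\<dots> = of_nat (Suc t choose k) * of_nat (walk_count G k i) * q ^ (k + card T)"
      unfolding \<open>k = Suc l\<close> binomial_Suc_Suc of_nat_add by (simp only: distrib_right add.commute)
    finally show ?thesis .
  qed
qed

corollary nn_integral_lazy_walk_sum:
  assumes "random_deletions M G p absent" "iid_noise M G \<mu> v"
    and "deletions_indep_noise M G absent v" "pair_graph G"
  shows "(\<integral>\<^sup>+\<omega>. lazy_walk_sum G (exp_weight absent v \<gamma> \<omega>) t k i \<partial>M) =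
    of_nat (t choose k) * of_nat (walk_count G k i) * (ennreal (1 - p) * mgf \<mu> \<gamma>) ^ k"
  using nn_integral_lazy_walk_sum_prod[OF assms, of "{}" t undefined \<gamma> k i] by simp

end

section \<open>Chernoff bound\<close>

text \<open>With \<open>b = k / t\<close>, one term of the expansion of
  \<open>(b + (1 - b)) ^ t = 1\<close> is the binomial coefficient times
  \<open>b ^ k * (1 - b) ^ (t - k)\<close>, and the latter factor is exactly
  \<open>exp (- (t * entropy_fun b))\<close>.\<close>

lemma binomial_le_exp_entropy:
  assumes "k \<le> t" "t > 0"
  shows "real (t choose k) \<le> exp (real t * entropy_fun (real k / real t))"
proof (cases "k = 0 \<or> k = t")
  \<comment> \<open>At both ends the coefficient is 1 and the entropy 0; in between both logarithms
    have positive arguments.\<close>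
  case True
  thus ?thesis using assms by (auto simp: entropy_fun_def)
next
  case False
  define b where "b = real k / real t"
  have b: "0 < b" "b < 1" using False assms by (auto simp: b_def)
  have "real (t choose k) * b ^ k * (1 - b) ^ (t - k) \<le>
      (\<Sum>j\<le>t. real (t choose j) * b ^ j * (1 - b) ^ (t - j))"
    using assms b by (intro member_le_sum) auto
  also have "\<dots> = 1" using binomial_ring[of b "1 - b" t] by simp
  finally have *: "real (t choose k) * (b ^ k * (1 - b) ^ (t - k)) \<le> 1" by (simp add: mult.assoc)
  have "exp (- (real t * entropy_fun b)) = exp (real k * ln b + real (t - k) * ln (1 - b))"
    using assms by (simp add: entropy_fun_def b_def field_simps of_nat_diff)
  also have "\<dots> = b ^ k * (1 - b) ^ (t - k)"
    using b by (simp add: exp_add exp_of_nat_mult)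
  finally have "real (t choose k) * exp (- (real t * entropy_fun b)) \<le> 1" using * by simp
  thus ?thesis by (simp add: exp_minus field_simps b_def)
qed

text \<open>Near 0 the term \<open>- b * ln b\<close> dominates every linear term.\<close>

lemma entropy_plus_linear_nonneg:
  obtains b where "0 < b" "b \<le> 1" "entropy_fun b + b * c \<ge> 0"
proof
  \<comment> \<open>\<open>b \<le> exp c\<close> yields \<open>ln b \<le> c\<close>, and
    \<open>b \<le> 1 / 2\<close> keeps \<open>1 - b\<close> positive.\<close>
  define b where "b = min (1 / 2) (exp c)"
  show b: "0 < b" "b \<le> 1" by (auto simp: b_def)
  have "ln b \<le> ln (exp c)" using b by (intro ln_mono) (auto simp: b_def)
  hence "b * (c - ln b) \<ge> 0" using b by simp
  moreover have "(1 - b) * ln (1 - b) \<le> 0"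
    using b by (intro mult_nonneg_nonpos) (auto simp: b_def)
  ultimately show "entropy_fun b + b * c \<ge> 0" by (simp add: entropy_fun_def algebra_simps)
qed

text \<open>Jensen's inequality: integrate \<open>1 + \<gamma> * y \<le> exp (\<gamma> * y)\<close>
  against a law of mean zero. This is the source of \<open>L \<ge> 0\<close> in the bounds
  below.\<close>

lemma mgf_ge_1:
  assumes "prob_space \<mu>" "sets \<mu> = sets borel" "has_bochner_integral \<mu> (\<lambda>y. y) 0"
  shows "mgf \<mu> \<gamma> \<ge> 1"
proof (cases "mgf \<mu> \<gamma> = \<infinity>")
  case False
  interpret prob_space \<mu> by fact
  have int: "integrable \<mu> (\<lambda>y. y)" and 0: "(\<integral>y. y \<partial>\<mu>) = 0"
    using assms(3) by (auto simp: has_bochner_integral_iff)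
  have [measurable]: "(\<lambda>y. y) \<in> borel_measurable \<mu>" using int by auto
  have "(\<lambda>y. exp (\<gamma> * y)) \<in> borel_measurable \<mu>" by measurable
  hence int': "integrable \<mu> (\<lambda>y. exp (\<gamma> * y))"
    using False by (intro integrableI_nonneg) (auto simp: mgf_def top.not_eq_extremum)
  have "1 = (\<integral>y. 1 + \<gamma> * y \<partial>\<mu>)" using int 0 by (simp add: prob_space)
  also have "\<dots> \<le> (\<integral>y. exp (\<gamma> * y) \<partial>\<mu>)"
    using int int' by (intro integral_mono) (auto simp: exp_ge_add_one_self)
  finally have "1 \<le> (\<integral>y. exp (\<gamma> * y) \<partial>\<mu>)" .
  thus ?thesis
    unfolding mgf_def using int' by (subst nn_integral_eq_integral) (auto simp flip: ennreal_1 intro: ennreal_leI)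
qed auto

lemma less_rate_functionE:
  assumes "ereal y < rate_function \<mu> x" and ge: "\<And>\<gamma>. mgf \<mu> \<gamma> \<ge> 1"
  obtains \<gamma> L where "\<gamma> > 0" "mgf \<mu> \<gamma> = ennreal (exp L)" "L \<ge> 0" "y < x * \<gamma> - L"
proof -
  obtain \<gamma> where g: "\<gamma> > 0" "ereal y < ereal (x * \<gamma>) - log_mgf \<mu> \<gamma>"
    using assms(1) unfolding rate_function_def less_SUP_iff by auto
  \<comment> \<open>An infinite \<open>mgf\<close> would turn the right-hand side into
    \<open>-\<infinity>\<close>.\<close>
  hence fin: "mgf \<mu> \<gamma> \<noteq> \<infinity>" by (auto simp: log_mgf_def)
  define m where "m = enn2real (mgf \<mu> \<gamma>)"
  have m: "mgf \<mu> \<gamma> = ennreal m" using fin by (auto simp: m_def less_top)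
  with ge[of \<gamma>] have "m \<ge> 1" by (metis ennreal_1 ennreal_le_iff2 less_eq_real_def not_one_le_zero)
  moreover have "log_mgf \<mu> \<gamma> = ereal (ln m)" using fin by (simp add: log_mgf_def m_def)
  ultimately show ?thesis using g m by (intro that[of \<gamma> "ln m"]) auto
qed

text \<open>A strictly negative supremum leaves a gap \<open>d\<close> that is uniform in
  \<open>\<beta>\<close>. For each positive \<open>\<beta>\<close> the supremum defining the rate
  function then supplies a Chernoff parameter \<open>\<gamma>\<close> of its own.\<close>

lemma scaled_rate_boundE:
  assumes neg: "(SUP \<beta>\<in>{0..1}. ereal (entropy_fun \<beta> + \<beta> * c) - scaled_rate \<mu> x \<beta>) < 0"
    and ge: "\<And>\<gamma>. mgf \<mu> \<gamma> \<ge> 1"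
  obtains d where "d > 0" "\<And>\<beta>. 0 < \<beta> \<Longrightarrow> \<beta> \<le> 1 \<Longrightarrow>
    \<exists>\<gamma> L. \<gamma> > 0 \<and> mgf \<mu> \<gamma> = ennreal (exp L) \<and> L \<ge> 0 \<and> entropy_fun \<beta> + \<beta> * (c + L) + d < \<gamma> * x"
proof -
  obtain z where z: "(SUP \<beta>\<in>{0..1}. ereal (entropy_fun \<beta> + \<beta> * c) - scaled_rate \<mu> x \<beta>) < ereal z" "z < 0"
    using ereal_dense2[OF neg] by auto
  show ?thesis
  proof (rule that[of "- z"])
    show "- z > 0" using z by simp
    fix \<beta> :: real assume b: "0 < \<beta>" "\<beta> \<le> 1"
    let ?h = "entropy_fun \<beta> + \<beta> * c"
    have "ereal ?h - scaled_rate \<mu> x \<beta> < ereal z"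
      by (rule le_less_trans[OF SUP_upper z(1)]) (use b in auto)
    hence lt: "ereal ?h - ereal \<beta> * rate_function \<mu> (x / \<beta>) < ereal z"
      using b by (simp add: scaled_rate_def)
    \<comment> \<open>Arguing by contradiction covers infinite values of the rate function too: a
      smaller rate would lift the difference in \<open>lt\<close> to at least
      \<open>z\<close>.\<close>
    have "ereal ((?h - z) / \<beta>) < rate_function \<mu> (x / \<beta>)"
    proof (rule ccontr)
      assume "\<not> ?thesis"
      hence "ereal \<beta> * rate_function \<mu> (x / \<beta>) \<le> ereal \<beta> * ereal ((?h - z) / \<beta>)"
        using b by (intro ereal_mult_left_mono) auto
      also have "\<dots> = ereal (?h - z)" using b by simp
      finally have "ereal ?h - ereal (?h - z) \<le> ereal ?h - ereal \<beta> * rate_function \<mu> (x / \<beta>)"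
        by (intro ereal_minus_mono) auto
      with lt show False by simp
    qed
    then obtain \<gamma> L where g: "\<gamma> > 0" "mgf \<mu> \<gamma> = ennreal (exp L)" "L \<ge> 0"
        "(?h - z) / \<beta> < x / \<beta> * \<gamma> - L"
      using less_rate_functionE[OF _ ge] by metis
    hence "?h - z < (x / \<beta> * \<gamma> - L) * \<beta>" using b by (simp only: pos_divide_less_eq)
    also have "\<dots> = \<gamma> * x - \<beta> * L" using b by (simp add: field_simps)
    finally have "?h - z < \<gamma> * x - \<beta> * L" .
    with g show "\<exists>\<gamma> L. \<gamma> > 0 \<and> mgf \<mu> \<gamma> = ennreal (exp L) \<and> L \<ge> 0 \<and>
        entropy_fun \<beta> + \<beta> * (c + L) + - z < \<gamma> * x"
      by (intro exI[of _ \<gamma>] exI[of _ L]) (auto simp: algebra_simps)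
  qed
qed

section \<open>Tail bounds and almost sure limits\<close>

context prob_space
begin

text \<open>Markov's inequality for the exact expectation of the lazy walk sum. The entropy bounds
  the binomial coefficient, \<open>C * r ^ k\<close> bounds the walk count, and all powers are
  gathered in one exponent.\<close>

lemma emeasure_lazy_walk_sum_ge:
  assumes del: "random_deletions M G p absent" and noise: "iid_noise M G \<mu> v"
    and indep: "deletions_indep_noise M G absent v" and G: "pair_graph G"
    and L: "mgf \<mu> \<gamma> = ennreal (exp L)" and p: "p < 1" and r: "r > 0"
    and C: "real (walk_count G k i) \<le> C * r ^ k" and k: "k \<le> t" "t > 0"
  shows "emeasure M {\<omega> \<in> space M. ennreal (exp y) \<le> lazy_walk_sum G (exp_weight absent v \<gamma> \<omega>) t k i} \<le>
    ennreal (C * exp (real t * entropy_fun (real k / real t) + real k * (ln (r * (1 - p)) + L) - y))"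
proof -
  let ?U = "\<lambda>\<omega>. lazy_walk_sum G (exp_weight absent v \<gamma> \<omega>) t k i"
  define m where "m = (1 - p) * exp L"
  have m: "m \<ge> 0" using p by (simp add: m_def)
  have q: "ennreal (1 - p) * mgf \<mu> \<gamma> = ennreal m"
    using p by (simp add: L m_def ennreal_mult)
  \<comment> \<open>Markov's inequality is applied at level 1, so the threshold becomes the factor
    \<open>exp (- y)\<close>.\<close>
  have "{\<omega> \<in> space M. ennreal (exp y) \<le> ?U \<omega>} = {\<omega> \<in> space M. 1 \<le> ennreal (exp (- y)) * ?U \<omega>}"
  proof -
    have "ennreal (exp y) \<le> u \<longleftrightarrow> 1 \<le> ennreal (exp (- y)) * u" for u
    proof
      assume "ennreal (exp y) \<le> u"
      from mult_left_mono[OF this, of "ennreal (exp (- y))"]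
      show "1 \<le> ennreal (exp (- y)) * u" by (simp flip: ennreal_mult exp_add)
    next
      assume "1 \<le> ennreal (exp (- y)) * u"
      from mult_left_mono[OF this, of "ennreal (exp y)"]
      show "ennreal (exp y) \<le> u" by (simp flip: ennreal_mult exp_add mult.assoc)
    qed
    thus ?thesis by simp
  qed
  also have "emeasure M \<dots> \<le> ennreal (exp (- y)) * (\<integral>\<^sup>+\<omega>\<in>space M. ?U \<omega> \<partial>M)"
  proof (rule nn_integral_Markov_inequality)
    show "(\<lambda>\<omega>. ?U \<omega> * indicator (space M) \<omega>) \<in> borel_measurable M"
      using measurable_lazy_walk_sum[OF del noise G] by simp
  qed simp
  also have "(\<integral>\<^sup>+\<omega>\<in>space M. ?U \<omega> \<partial>M) = (\<integral>\<^sup>+\<omega>. ?U \<omega> \<partial>M)"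
    by (intro nn_integral_cong) auto
  also have "(\<integral>\<^sup>+\<omega>. ?U \<omega> \<partial>M) =
      ennreal (real (t choose k) * (real (walk_count G k i) * m ^ k))"
    unfolding nn_integral_lazy_walk_sum[OF del noise indep G] q
    using m by (simp add: ennreal_power ennreal_mult mult.assoc ennreal_of_nat_eq_real_of_nat)
  also have "ennreal (exp (- y)) * \<dots> = ennreal (exp (- y) *
      (real (t choose k) * (real (walk_count G k i) * m ^ k)))"
    using m by (intro ennreal_mult[symmetric]) auto
  also have "\<dots> \<le> ennreal (exp (- y) *
      (exp (real t * entropy_fun (real k / real t)) * ((C * r ^ k) * m ^ k)))"
    using m C r binomial_le_exp_entropy[OF k]
    by (intro ennreal_leI mult_left_mono mult_mono mult_right_mono) auto
  also have "C * r ^ k * m ^ k = C * exp (real k * (ln (r * (1 - p)) + L))"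
    using p r by (simp add: m_def exp_of_nat_mult exp_add power_mult_distrib)
  finally show ?thesis
    by (simp add: exp_add exp_diff exp_minus field_simps)
qed

text \<open>Fatou's lemma for indicators: their lower limit is 1 almost everywhere, so the lower
  limit of the probabilities is at least 1.\<close>

lemma AE_eventually_imp_not_tendsto_0:
  assumes ev: "AE \<omega> in M. \<forall>\<^sub>F t in sequentially. \<omega> \<in> F t"
    and F: "\<And>t. F t \<in> events"
  shows "\<not> (\<lambda>t. emeasure M (F t)) \<longlonglongrightarrow> 0"
proof
  assume lim: "(\<lambda>t. emeasure M (F t)) \<longlonglongrightarrow> 0"
  have "AE \<omega> in M. liminf (\<lambda>t. indicator (F t) \<omega> :: ennreal) = 1"
    using ev
  proof eventually_elim
    case (elim \<omega>)
    hence "(\<lambda>t. indicator (F t) \<omega> :: ennreal) \<longlonglongrightarrow> 1"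
      by (intro tendsto_eventually) (auto elim: eventually_mono)
    thus ?case by (intro lim_imp_Liminf) auto
  qed
  hence "(\<integral>\<^sup>+\<omega>. liminf (\<lambda>t. indicator (F t) \<omega>) \<partial>M) = (\<integral>\<^sup>+\<omega>. 1 \<partial>M)"
    by (rule nn_integral_cong_AE)
  hence "1 = (\<integral>\<^sup>+\<omega>. liminf (\<lambda>t. indicator (F t) \<omega>) \<partial>M)"
    by (simp add: emeasure_space_1)
  also have "\<dots> \<le> liminf (\<lambda>t. \<integral>\<^sup>+\<omega>. indicator (F t) \<omega> \<partial>M)"
    using F by (intro nn_integral_liminf) auto
  also have "\<dots> = 0"
    using lim F by (subst nn_integral_indicator) (auto intro: lim_imp_Liminf)
  finally show False by simp
qed

text \<open>If \<open>x < lam\<close>, the process almost surely exceeds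
  \<open>x * real t + c\<close> from some time on, since \<open>c / real t\<close> vanishes. Then
  almost every point is eventually in \<open>F t\<close>, against the vanishing
  probabilities.\<close>

lemma AE_limit_le_of_tail:
  assumes lim: "AE \<omega> in M. (\<lambda>t. y \<omega> t / real t) \<longlonglongrightarrow> lam"
    and F: "\<And>t. F t \<in> events" "(\<lambda>t. emeasure M (F t)) \<longlonglongrightarrow> 0"
    and tail: "\<And>t \<omega>. t > 0 \<Longrightarrow> \<omega> \<in> space M \<Longrightarrow> x * real t + c < y \<omega> t \<Longrightarrow> \<omega> \<in> F t"
  shows "lam \<le> x"
proof (rule ccontr)
  assume "\<not> lam \<le> x"
  hence less: "x < lam" by simp
  from lim AE_space have "AE \<omega> in M. \<forall>\<^sub>F t in sequentially. \<omega> \<in> F t"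
  proof eventually_elim
    case (elim \<omega>)
    have "(\<lambda>t. c / real t) \<longlonglongrightarrow> 0" by (rule lim_const_over_n)
    from tendsto_diff[OF elim(1) this] have "\<forall>\<^sub>F t in sequentially. y \<omega> t / real t - c / real t > x"
      using less by (intro order_tendstoD(1)) auto
    thus ?case using eventually_gt_at_top[of "0 :: nat"]
    proof eventually_elim
      case (elim t)
      thus ?case using \<open>\<omega> \<in> space M\<close>
        by (intro tail) (auto simp: field_simps)
    qed
  qed
  from AE_eventually_imp_not_tendsto_0[OF this] F show False by blast
qed

end

section \<open>The growth rate\<close>

theorem mainTheorem6:
  fixes N :: nat
    and G :: "nat pair_pre_digraph"
    and p lam :: real
    and P :: "'w measure"
    and absent :: "nat \<times> nat \<Rightarrow> nat \<Rightarrow> 'w \<Rightarrow> bool"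
    and v :: "nat \<times> nat \<Rightarrow> nat \<Rightarrow> 'w \<Rightarrow> real"
    and \<mu> :: "real measure"
    and x0 :: "nat \<Rightarrow> real"
  defines "\<rho> \<equiv> spectral_radius (adjacency_matrix G N)"
  assumes "N \<ge> 2"
    and "pair_graph G" and "pverts G = {1..N}"
    and "Digraph_Component.connected (with_proj G)"
    and "0 \<le> p" and "p < 1"
    and "prob_space P"
    and "random_deletions P G p absent"
    and "iid_noise P G \<mu> v"
    and "deletions_indep_noise P G absent v"
    and "has_bochner_integral \<mu> (\<lambda>y. y) 0"
    and "\<exists>\<epsilon>>0. \<forall>\<gamma>. \<bar>\<gamma>\<bar> < \<epsilon> \<longrightarrow> mgf \<mu> \<gamma> < \<infinity>"
    and "growth_rate P G (\<lambda>\<omega>. consensus_state G (link_weight absent v \<omega>) x0) lam"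
  shows "ereal lam \<le>
    (INF x\<in>{x. (SUP \<beta>\<in>{0..1}.
                 ereal (entropy_fun \<beta> + \<beta> * ln (\<rho> * (1 - p))) - scaled_rate \<mu> x \<beta>) < 0}. ereal x)"
proof (rule INF_greatest)
  fix x
  assume "x \<in> {x. (SUP \<beta>\<in>{0..1}.
      ereal (entropy_fun \<beta> + \<beta> * ln (\<rho> * (1 - p))) - scaled_rate \<mu> x \<beta>) < 0}"
  hence neg: "(SUP \<beta>\<in>{0..1}.
      ereal (entropy_fun \<beta> + \<beta> * ln (\<rho> * (1 - p))) - scaled_rate \<mu> x \<beta>) < 0" by simp
  interpret pair_graph G by fact
  interpret prob_space P by fact
  note del = \<open>random_deletions P G p absent\<close> and noise = \<open>iid_noise P G \<mu> v\<close>
    and indep = \<open>deletions_indep_noise P G absent v\<close> and G = \<open>pair_graph G\<close>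
    and V = \<open>pverts G = {1..N}\<close> and N = \<open>N \<ge> 2\<close> and p = \<open>p < 1\<close>
  have fin: "finite (neighbors G i)" for i
    by (rule finite_neighbors[OF G])
  have closed: "neighbors G i \<subseteq> pverts G" for i
    using arc_snd_in_verts by (force simp: neighbors_def)

  \<comment> \<open>Positivity of the spectral radius and the sign of \<open>x\<close>\<close>
  obtain i j where arc: "(i, j) \<in> parcs G"
    using connected_graph_has_arc[OF G \<open>Digraph_Component.connected (with_proj G)\<close>, of 1 2] V N
    by auto
  have \<rho>: "\<rho> > 0" unfolding \<rho>_def by (rule spectral_radius_adjacency_pos[OF G V arc])
  have i: "i \<in> pverts G" using arc_fst_in_verts[OF arc] by simp
  \<comment> \<open>As the distribution of an actual noise variable, which the arc supplies,
    \<open>\<mu>\<close> is a probability measure on the Borel sets.\<close>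
  have "distr P borel (v (i, j) 0) = \<mu>" "v (i, j) 0 \<in> borel_measurable P"
    using noise arc by (auto simp: iid_noise_def indep_vars_def)
  hence "prob_space \<mu>" "sets \<mu> = sets borel" using prob_space_distr by auto
  hence ge1: "mgf \<mu> \<gamma> \<ge> 1" for \<gamma>
    by (intro mgf_ge_1 \<open>has_bochner_integral \<mu> (\<lambda>y. y) 0\<close>)
  obtain d where d: "d > 0" and bound: "\<And>\<beta>. 0 < \<beta> \<Longrightarrow> \<beta> \<le> 1 \<Longrightarrow>
      \<exists>\<gamma> L. \<gamma> > 0 \<and> mgf \<mu> \<gamma> = ennreal (exp L) \<and> L \<ge> 0 \<and>
        entropy_fun \<beta> + \<beta> * (ln (\<rho> * (1 - p)) + L) + d < \<gamma> * x"
    using scaled_rate_boundE[OF neg ge1] by blast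
  have x: "x \<ge> 0"
  proof -
    \<comment> \<open>For this \<open>b\<close>, and with \<open>L \<ge> 0\<close>, the left side of
      \<open>bound\<close> is positive, hence so is \<open>\<gamma> * x\<close>.\<close>
    obtain b where b: "0 < b" "b \<le> 1" "entropy_fun b + b * ln (\<rho> * (1 - p)) \<ge> 0"
      by (rule entropy_plus_linear_nonneg)
    then obtain \<gamma> L where "\<gamma> > 0" "L \<ge> 0" "entropy_fun b + b * (ln (\<rho> * (1 - p)) + L) + d < \<gamma> * x"
      using bound by blast
    moreover have "b * L \<ge> 0" using b \<open>L \<ge> 0\<close> by simp
    ultimately have "\<gamma> * x > 0" using b d unfolding distrib_left by linarith
    thus ?thesis using \<open>\<gamma> > 0\<close> by (simp add: zero_less_mult_iff)
  qed

  \<comment> \<open>Half of the gap \<open>d\<close> pays for raising \<open>\<rho>\<close> to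
    \<open>r\<close>, where the walk counts are at most \<open>C * r ^ k\<close>; the other half
    becomes the rate of decay.\<close>
  define r where "r = \<rho> * exp (d / 2)"
  have r: "r > 0" "\<rho> < r" using \<rho> d by (auto simp: r_def)
  have ln_r: "ln (r * (1 - p)) = ln (\<rho> * (1 - p)) + d / 2"
    using \<rho> p by (simp add: r_def ln_mult)
  obtain C where C: "\<And>k i. i \<in> pverts G \<Longrightarrow> real (walk_count G k i) \<le> C * r ^ k"
    using walk_count_bound[OF G V _ r(2)[unfolded \<rho>_def] r(1)] N by auto
  have C0: "C \<ge> 0" using C[OF i, of 0] by simp

  \<comment> \<open>The inequality says that the exponent of the tail bound at the threshold
    \<open>\<gamma> * (x * real t)\<close> is at most \<open>- (d / 2) * real t\<close>.\<close>
  define good where "good t k \<gamma> L \<longleftrightarrow> \<gamma> > 0 \<and> mgf \<mu> \<gamma> = ennreal (exp L) \<and>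
      real t * entropy_fun (real k / real t) + real k * (ln (r * (1 - p)) + L) - \<gamma> * (x * real t)
        \<le> - (d / 2) * real t" for t k :: nat and \<gamma> L
  have "\<exists>\<gamma> L. good t k \<gamma> L" if k: "k \<in> {1..t}" for t k
  proof -
    define b where "b = real k / real t"
    have t: "t > 0" and b: "0 < b" "b \<le> 1" and kb: "real k = b * real t" using k by (auto simp: b_def)
    obtain \<gamma> L where g: "\<gamma> > 0" "mgf \<mu> \<gamma> = ennreal (exp L)"
        "entropy_fun b + b * (ln (\<rho> * (1 - p)) + L) + d < \<gamma> * x"
      using bound[OF b] by blast
    have "b * (d / 2) \<le> d / 2" using b d by (simp add: mult_left_le_one_le)
    hence "entropy_fun b + b * (ln (r * (1 - p)) + L) - \<gamma> * x \<le> - (d / 2)"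
      using g(3) unfolding ln_r distrib_left by linarith
    hence "(entropy_fun b + b * (ln (r * (1 - p)) + L) - \<gamma> * x) * real t \<le> - (d / 2) * real t"
      by (rule mult_right_mono) simp
    with g show ?thesis
      unfolding good_def b_def[symmetric] kb by (intro exI[of _ \<gamma>] exI[of _ L]) (simp add: algebra_simps)
  qed
  \<comment> \<open>With the premise inside the quantifiers, choice gives total functions
    \<open>\<gamma>\<close> and \<open>L\<close>; their values for \<open>k\<close> outside
    \<open>{1..t}\<close> are arbitrary.\<close>
  hence "\<forall>t k. \<exists>\<gamma> L. k \<in> {1..t} \<longrightarrow> good t k \<gamma> L" by blast
  then obtain \<gamma> L where "\<And>t k. k \<in> {1..t} \<Longrightarrow> good t k (\<gamma> t k) (L t k)"
    unfolding choice_iff by blast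
  hence g: "\<And>t k. k \<in> {1..t} \<Longrightarrow> \<gamma> t k > 0"
      "\<And>t k. k \<in> {1..t} \<Longrightarrow> mgf \<mu> (\<gamma> t k) = ennreal (exp (L t k))"
      "\<And>t k. k \<in> {1..t} \<Longrightarrow> real t * entropy_fun (real k / real t) +
        real k * (ln (r * (1 - p)) + L t k) - \<gamma> t k * (x * real t) \<le> - (d / 2) * real t"
    by (auto simp only: good_def)

  \<comment> \<open>Bad events and their probabilities\<close>
  define U where "U t k \<omega> = lazy_walk_sum G (exp_weight absent v (\<gamma> t k) \<omega>) t k i" for t k \<omega>
  \<comment> \<open>Each \<open>k\<close> is tested with its own parameter
    \<open>\<gamma> t k\<close>, which the union bound over \<open>k\<close> permits.\<close>
  define F where "F t = (\<Union>k\<in>{1..t}. {\<omega> \<in> space P. ennreal (exp (\<gamma> t k * (x * real t))) \<le> U t k \<omega>})" for t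
  have [measurable]: "U t k \<in> borel_measurable P" for t k
    unfolding U_def by (rule measurable_lazy_walk_sum[OF del noise G])
  have meas: "{\<omega> \<in> space P. ennreal (exp (\<gamma> t k * (x * real t))) \<le> U t k \<omega>} \<in> events" for t k
    by measurable
  have F: "F t \<in> events" for t unfolding F_def using meas by auto
  have F_le: "emeasure P (F t) \<le> ennreal (real t * (C * exp (- (d / 2) * real t)))" for t
  proof -
    have "emeasure P (F t) \<le>
        (\<Sum>k\<in>{1..t}. emeasure P {\<omega> \<in> space P. ennreal (exp (\<gamma> t k * (x * real t))) \<le> U t k \<omega>})"
      unfolding F_def using meas by (intro emeasure_subadditive_finite) auto
    also have "\<dots> \<le> (\<Sum>k\<in>{1..t}. ennreal (C * exp (- (d / 2) * real t)))"
    proof (rule sum_mono)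
      fix k assume k: "k \<in> {1..t}"
      hence "emeasure P {\<omega> \<in> space P. ennreal (exp (\<gamma> t k * (x * real t))) \<le> U t k \<omega>} \<le>
          ennreal (C * exp (real t * entropy_fun (real k / real t) +
            real k * (ln (r * (1 - p)) + L t k) - \<gamma> t k * (x * real t)))"
        unfolding U_def
        by (intro emeasure_lazy_walk_sum_ge[OF del noise indep G g(2) p r(1) C[OF i]]) auto
      also have "\<dots> \<le> ennreal (C * exp (- (d / 2) * real t))"
        using g(3)[OF k] C0 by (intro ennreal_leI mult_left_mono) auto
      finally show "emeasure P {\<omega> \<in> space P. ennreal (exp (\<gamma> t k * (x * real t))) \<le> U t k \<omega>} \<le>
          ennreal (C * exp (- (d / 2) * real t))" .
    qed
    also have "\<dots> = ennreal (real t * (C * exp (- (d / 2) * real t)))"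
      using C0 by (simp add: ennreal_mult ennreal_of_nat_eq_real_of_nat)
    finally show ?thesis .
  qed
  \<comment> \<open>Exponential decay beats the factor \<open>real t\<close> left by the union
    bound.\<close>
  have F_lim: "(\<lambda>t. ennreal (real t * (C * exp (- (d / 2) * real t)))) \<longlonglongrightarrow> ennreal 0"
    using d by (intro tendsto_ennrealI) real_asymp
  have F0: "(\<lambda>t. emeasure P (F t)) \<longlonglongrightarrow> 0"
    using tendsto_sandwich[OF always_eventually always_eventually tendsto_const F_lim[unfolded ennreal_0]]
      F_le by simp

  \<comment> \<open>Large states lie in the bad events\<close>
  define c where "c = Max (x0 ` pverts G)"
  have c: "x0 j \<le> c" if "j \<in> pverts G" for j
    using that pair_finite_verts by (auto simp: c_def)
  have "lam \<le> x"
  proof (rule AE_limit_le_of_tail[OF _ F F0])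
    show "AE \<omega> in P. (\<lambda>t. consensus_state G (link_weight absent v \<omega>) x0 t i / real t) \<longlonglongrightarrow> lam"
      using \<open>growth_rate P G _ lam\<close> i by (auto simp: growth_rate_def)
    fix t \<omega>
    let ?X = "consensus_state G (link_weight absent v \<omega>) x0 t i"
    assume "\<omega> \<in> space P" and big: "x * real t + c < ?X"
    obtain k where "k \<le> t" and k: "\<And>g. g \<ge> 0 \<Longrightarrow> ennreal (exp (g * (?X - c))) \<le>
        lazy_walk_sum G (exp_weight absent v g \<omega>) t k i"
      using exp_consensus_state_le_lazy_walk_sum[of G "pverts G" x0 c i t absent v \<omega>, OF fin closed c i]
      by auto
    \<comment> \<open>Without moves the walk sum is 1 for every parameter; parameter 1 then bounds
      the state by \<open>c\<close>, which contradicts \<open>big\<close> because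
      \<open>x \<ge> 0\<close>.\<close>
    have "k \<noteq> 0"
    proof
      assume "k = 0"
      hence "exp (?X - c) \<le> 1" using k[of 1] by simp
      moreover have "x * real t \<ge> 0" using x by simp
      ultimately show False using big by simp
    qed
    with \<open>k \<le> t\<close> have kt: "k \<in> {1..t}" by simp
    have "ennreal (exp (\<gamma> t k * (x * real t))) \<le> ennreal (exp (\<gamma> t k * (?X - c)))"
      using g(1)[OF kt] big by (intro ennreal_leI) auto
    also have "\<dots> \<le> U t k \<omega>" unfolding U_def using g(1)[OF kt] by (intro k) simp
    finally show "\<omega> \<in> F t" using kt \<open>\<omega> \<in> space P\<close> by (auto simp: F_def)
  qed
  thus "ereal lam \<le> ereal x" by simp
qed

end
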